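(* Let $m$ and $p$ be positive integers, and let $z\ge 0$ and $k\ge 1$ be the unique integers such that $m=k2^z$ with $k$ odd. Then the state complexity of $m\mathcal{T}=\{mt : t\in\mathcal{T}\}$ with respect to the base $2^p$ is equal to \[ 2k+\left\lceil \frac zp\right\rceil . \]
   Context: $\mathcal{T}\subseteq\mathbb{N}=\{0,1,2,\dots\}$ is the Thue-Morse set, i.e. the set of natural numbers whose base-$2$ expansion contains an even number of occurrences of the digit $1$. For an integer base $b\ge 2$, let $A_b=\{0,1,\dots,b-1\}$ and, for a finite word $w=c_{\ell-1}\cdots c_0$ over $A_b$, let $\mathrm{val}_b(w)=\sum_{j=0}^{\ell-1}c_jb^j$ (with value $0$ for the empty word). For $X\subseteq\mathbb{N}$, $\mathrm{val}_b^{-1}(X)=\{w\in A_b^* : \mathrm{val}_b(w)\in X\}$ (leading zeros allowed; words are read most significant digit first). The state complexity of a regular language $L\subseteq A^*$ is the number of its distinct left quotients $w^{-1}L=\{u\in A^* : wu\in L\}$, $w\in A^*$; equivalently, the number of states of its (complete) minimal deterministic automaton. The state complexity of $X$ with respect to the base $b$ is the state complexity of the language $\mathrm{val}_b^{-1}(X)$. *)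

theory Defs
  imports Complex_Main
begin

text \<open>\<^term>\<open>bit n i\<close> says that the digit of weight \<^term>\<open>2 ^ i\<close> in the binary expansion of
  \<^term>\<open>n\<close> is 1; for natural numbers the set below is finite.\<close>

definition thue_morse :: "nat set" where
  "thue_morse = {n. even (card {i. bit n i})}"

text \<open>Words are lists of natural numbers, most significant digit first, so
  \<^term>\<open>rev w ! j\<close> is the digit of weight \<^term>\<open>b ^ j\<close>.\<close>

definition val :: "nat \<Rightarrow> nat list \<Rightarrow> nat" where
  "val b w = (\<Sum>j<length w. rev w ! j * b ^ j)"

definition val_lang :: "nat \<Rightarrow> nat set \<Rightarrow> nat list set" where
  "val_lang b X = {w \<in> lists {..<b}. val b w \<in> X}"

definition left_quotient :: "'a set \<Rightarrow> 'a list \<Rightarrow> 'a list set \<Rightarrow> 'a list set" where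
  "left_quotient A w L = {u \<in> lists A. w @ u \<in> L}"

text \<open>Since \<^const>\<open>card\<close> is 0 on infinite sets, and every language has at least one left quotient,
  this is positive exactly if there are finitely many left quotients, that is (for a finite
  alphabet), if the language is regular.\<close>

definition state_complexity :: "'a set \<Rightarrow> 'a list set \<Rightarrow> nat" where
  "state_complexity A L = card {left_quotient A w L | w. w \<in> lists A}"

definition state_complexity_base :: "nat \<Rightarrow> nat set \<Rightarrow> nat" where
  "state_complexity_base b X = state_complexity {..<b} (val_lang b X)"

end

theory Submission
  imports Defs
begin

text \<open>The left quotient by \<open>w\<close> depends only on \<open>n = val w\<close>: it records the pairs \<open>(\<ell>, r)\<close> with
  \<open>r < 2 ^ (p * \<ell>)\<close> and \<open>n * 2 ^ (p * \<ell>) + r \<in> m\<T>\<close>. Write \<open>n = k * d + i\<close> with \<open>i < k\<close>. For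
  \<open>p * \<ell> \<ge> z\<close> the quotient \<open>(n * 2 ^ (p * \<ell>) + r) / m\<close> is \<open>d\<close> followed by a block of
  \<open>p * \<ell> - z\<close> bits that depends on \<open>i\<close> and \<open>r\<close> only, so these lengths see exactly \<open>i\<close> and whether
  \<open>d \<in> \<T>\<close>: this gives \<open>2 * k\<close> classes. For \<open>p * \<ell> < z\<close> only \<open>r = 0\<close> is possible, and then
  \<open>i = 0\<close>, \<open>d \<in> \<T>\<close> and \<open>2 ^ z dvd d * 2 ^ (p * \<ell>)\<close>. Hence the class \<open>i = 0\<close>, \<open>d \<in> \<T>\<close> splits
  according to the least \<open>\<ell>\<close> with this divisibility, which takes all values from \<open>0\<close> to
  \<open>\<lceil>z / p\<rceil>\<close>.\<close>

section \<open>Words and values\<close>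

lemma val_Nil [simp]: "val b [] = 0"
  by (simp add: val_def)

lemma val_snoc [simp]: "val b (w @ [c]) = val b w * b + c"
proof -
  have "val b (w @ [c]) = (\<Sum>j<Suc (length w). (c # rev w) ! j * b ^ j)"
    by (simp add: val_def)
  also have "\<dots> = c + (\<Sum>j<length w. rev w ! j * b ^ Suc j)"
    by (subst sum.lessThan_Suc_shift) simp
  also have "(\<Sum>j<length w. rev w ! j * b ^ Suc j) = val b w * b"
    by (simp add: val_def sum_distrib_left sum_distrib_right mult_ac)
  finally show ?thesis by simp
qed

lemma val_append: "val b (w @ u) = val b w * b ^ length u + val b u"
proof (induction u rule: rev_induct)
  case (snoc c u)
  show ?case
    by (simp only: append_assoc [symmetric] val_snoc snoc) (simp add: algebra_simps)
qed simp

lemma val_less: "w \<in> lists {..<b} \<Longrightarrow> val b w < b ^ length w"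
proof (induction w rule: rev_induct)
  case (snoc c w)
  then have "val b w + 1 \<le> b ^ length w" and "c < b"
    by auto
  have "(val b w + 1) * b \<le> b ^ length w * b"
    using \<open>val b w + 1 \<le> b ^ length w\<close> by (rule mult_le_mono1)
  with \<open>c < b\<close> show ?case
    by (simp add: algebra_simps)
qed simp

lemma val_surj_length:
  assumes "r < b ^ l"
  shows "\<exists>u \<in> lists {..<b}. length u = l \<and> val b u = r"
  using assms
proof (induction l arbitrary: r)
  case (Suc l)
  then have "b > 0"
    by (cases b) auto
  have "r div b < b ^ l"
    using Suc.prems by (simp add: less_mult_imp_div_less mult.commute)
  then obtain u where "u \<in> lists {..<b}" "length u = l" "val b u = r div b"
    using Suc.IH by blast
  then show ?case
    using \<open>b > 0\<close> by (intro bexI [of _ "u @ [r mod b]"]) auto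
qed simp

lemma val_surj:
  assumes "b \<ge> 2"
  shows "\<exists>w \<in> lists {..<b}. val b w = n"
proof -
  have "n < 2 ^ n"
    by (rule less_exp)
  also have "(2 :: nat) ^ n \<le> b ^ n"
    using assms by (rule power_mono) simp
  finally show ?thesis
    using val_surj_length by blast
qed

lemma left_quotient_val_lang:
  assumes "w \<in> lists {..<b}"
  shows "left_quotient {..<b} w (val_lang b X) =
    {u \<in> lists {..<b}. val b w * b ^ length u + val b u \<in> X}"
  using assms by (auto simp: left_quotient_def val_lang_def val_append)

section \<open>Counting left quotients through an invariant of values\<close>

lemma card_range_eq_if_same_kernel:
  assumes "\<And>x y. f x = f y \<longleftrightarrow> g x = g y"
  shows "card (range f) = card (range g)"
proof -
  have *: "g (inv f (f x)) = g x" for x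
    using assms f_inv_into_f [of "f x" f UNIV] by blast
  have "inj_on (\<lambda>y. g (inv f y)) (range f)"
    by (auto simp: inj_on_def * assms)
  then have "card ((\<lambda>y. g (inv f y)) ` range f) = card (range f)"
    by (rule card_image)
  then show ?thesis
    by (simp add: image_image *)
qed

text \<open>Every number is the value of some word, so the left quotients are indexed by numbers
  \<open>n\<close>. A continuation \<open>u\<close> matters only through its length \<open>l\<close>
  and value \<open>r\<close>, and every \<open>r < b ^ l\<close> occurs.\<close>

lemma state_complexity_base_eq_card_range:
  assumes "b \<ge> 2"
    and "\<And>n n'. (\<forall>l. \<forall>r < b ^ l. n * b ^ l + r \<in> X \<longleftrightarrow> n' * b ^ l + r \<in> X) \<longleftrightarrow> f n = f n'"
  shows "state_complexity_base b X = card (range f)"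
proof -
  define G where "G n = {u \<in> lists {..<b}. n * b ^ length u + val b u \<in> X}" for n
  have "{left_quotient {..<b} w (val_lang b X) | w. w \<in> lists {..<b}} =
      (\<lambda>w. left_quotient {..<b} w (val_lang b X)) ` lists {..<b}"
    by (rule Setcompr_eq_image)
  also have "\<dots> = (\<lambda>w. G (val b w)) ` lists {..<b}"
    by (rule image_cong) (simp_all add: left_quotient_val_lang G_def)
  also have "\<dots> = G ` val b ` lists {..<b}"
    by (simp only: image_image)
  also have "val b ` lists {..<b} = UNIV"
    using val_surj [OF assms(1)] by (auto simp: image_iff) metis
  finally have "{left_quotient {..<b} w (val_lang b X) | w. w \<in> lists {..<b}} = range G" .
  moreover have "G n = G n' \<longleftrightarrow> (\<forall>l. \<forall>r < b ^ l. n * b ^ l + r \<in> X \<longleftrightarrow> n' * b ^ l + r \<in> X)"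
    (is "_ \<longleftrightarrow> ?R") for n n'
  proof
    assume eq: "G n = G n'"
    show ?R
    proof (intro allI impI)
      fix l r assume "r < b ^ l"
      then obtain u where "u \<in> lists {..<b}" "length u = l" "val b u = r"
        using val_surj_length by blast
      moreover have "u \<in> G n \<longleftrightarrow> u \<in> G n'"
        using eq by simp
      ultimately show "n * b ^ l + r \<in> X \<longleftrightarrow> n' * b ^ l + r \<in> X"
        by (simp add: G_def)
    qed
  next
    assume ?R
    then show "G n = G n'"
      using val_less by (auto simp: G_def)
  qed
  ultimately show ?thesis
    unfolding state_complexity_base_def state_complexity_def
    by (simp add: card_range_eq_if_same_kernel [of G f] assms(2))
qed

section \<open>The Thue-Morse set\<close>

lemma finite_bits: "finite {i. bit (n :: nat) i}"
proof (rule finite_subset)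
  show "{i. bit n i} \<subseteq> {..n}"
  proof
    fix i assume "i \<in> {i. bit n i}"
    then have "2 ^ i \<le> n"
      by (auto simp: bit_iff_odd intro: ccontr)
    then have "i \<le> n"
      using less_exp [of i] by linarith
    then show "i \<in> {..n}"
      by simp
  qed
qed simp

lemma thue_morse_double: "2 * n \<in> thue_morse \<longleftrightarrow> n \<in> thue_morse"
proof -
  have "bit (2 * n) i \<longleftrightarrow> i \<in> Suc ` {i. bit n i}" for i
    by (cases i) (auto simp: bit_0 bit_Suc)
  then have "{i. bit (2 * n) i} = Suc ` {i. bit n i}"
    by blast
  then show ?thesis
    by (simp add: thue_morse_def card_image)
qed

lemma thue_morse_double_add_one: "2 * n + 1 \<in> thue_morse \<longleftrightarrow> n \<notin> thue_morse"
proof -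
  have "bit (2 * n + 1) i \<longleftrightarrow> i \<in> insert 0 (Suc ` {i. bit n i})" for i
    by (cases i) (auto simp: bit_0 bit_Suc)
  then have "{i. bit (2 * n + 1) i} = insert 0 (Suc ` {i. bit n i})"
    by blast
  then show ?thesis
    by (simp add: thue_morse_def card_image finite_bits)
qed

lemma zero_in_thue_morse: "0 \<in> thue_morse"
  by (simp add: thue_morse_def flip: bot_set_def)

lemma one_notin_thue_morse: "1 \<notin> thue_morse"
  using thue_morse_double_add_one [of 0] zero_in_thue_morse by simp

lemma three_in_thue_morse: "3 \<in> thue_morse"
  using thue_morse_double_add_one [of 1] one_notin_thue_morse by simp

text \<open>As \<open>s < 2 ^ e\<close>, the binary blocks of \<open>q\<close> and \<open>s\<close>
  do not overlap, so their counts of ones add up. The induction strips the lowest bit of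
  \<open>s\<close>.\<close>

lemma thue_morse_concat:
  assumes "s < 2 ^ e"
  shows "q * 2 ^ e + s \<in> thue_morse \<longleftrightarrow> (q \<in> thue_morse \<longleftrightarrow> s \<in> thue_morse)"
  using assms
proof (induction e arbitrary: s)
  case 0
  then show ?case
    by (simp add: zero_in_thue_morse)
next
  case (Suc e)
  define s' where "s' = s div 2"
  have "s' < 2 ^ e"
    using Suc.prems by (simp add: s'_def less_mult_imp_div_less mult.commute)
  note IH = Suc.IH [OF this]
  consider "s = 2 * s'" | "s = 2 * s' + 1"
    unfolding s'_def by linarith
  then show ?case
  proof cases
    case 1
    have "q * 2 ^ Suc e + s = 2 * (q * 2 ^ e + s')"
      by (simp add: 1)
    then show ?thesis
      using IH by (simp only: 1 thue_morse_double)
  next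
    case 2
    have "q * 2 ^ Suc e + s = 2 * (q * 2 ^ e + s') + 1"
      by (simp add: 2)
    then show ?thesis
      using IH by (simp only: 2 thue_morse_double_add_one) blast
  qed
qed

lemma thue_morse_mult_power: "q * 2 ^ e \<in> thue_morse \<longleftrightarrow> q \<in> thue_morse"
  using thue_morse_concat [of 0 e q] by (simp add: zero_in_thue_morse)

section \<open>Multiples of the Thue-Morse set\<close>

text \<open>Exactly one of \<open>2 * s\<close> and \<open>2 * s + 1\<close> lies in
  \<open>thue_morse\<close>, and an interval of length \<open>4 * m\<close> has room for both
  multiples of \<open>m\<close>.\<close>

lemma ex_multiple_in_interval:
  assumes "4 * m \<le> 2 ^ e" "m > 0"
  shows "\<exists>r < 2 ^ e. n * 2 ^ e + r \<in> {m * t | t. t \<in> thue_morse}"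
proof -
  \<comment> \<open>\<open>2 * m * s\<close> is the first multiple of \<open>2 * m\<close> strictly
    above \<open>n * 2 ^ e\<close>.\<close>
  define s where "s = n * 2 ^ e div (2 * m) + 1"
  have "n * 2 ^ e = (s - 1) * (2 * m) + n * 2 ^ e mod (2 * m)"
    unfolding s_def by (simp only: diff_add_inverse2 div_mult_mod_eq)
  moreover have "n * 2 ^ e mod (2 * m) < 2 * m"
    using assms by simp
  moreover have "2 * m * s = (s - 1) * (2 * m) + 2 * m"
    by (simp add: s_def algebra_simps)
  ultimately have s: "n * 2 ^ e \<le> 2 * m * s" "2 * m * s \<le> n * 2 ^ e + 2 * m"
    by linarith+
  obtain t where t: "t \<in> thue_morse" "t = 2 * s \<or> t = 2 * s + 1"
    using thue_morse_double thue_morse_double_add_one by blast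
  have "m * t = 2 * m * s \<or> m * t = 2 * m * s + m"
    using t(2) by (auto simp: algebra_simps)
  then have "n * 2 ^ e \<le> m * t" "m * t - n * 2 ^ e < 2 ^ e"
    using s assms by linarith+
  then show ?thesis
    using t(1) by (intro exI [of _ "m * t - n * 2 ^ e"]) auto
qed

text \<open>With \<open>2 ^ e = 2 ^ z * 2 ^ c\<close>, the summand \<open>k * d * 2 ^ e\<close>
  contributes \<open>d * 2 ^ c\<close> to the quotient. The rest contributes some
  \<open>s < 2 ^ c\<close>, so \<open>thue_morse_concat\<close> applies.\<close>

lemma concat_multiple_iff_long:
  assumes "z \<le> e" "i < k" "r < 2 ^ e"
  shows "(k * d + i) * 2 ^ e + r \<in> {k * 2 ^ z * t | t. t \<in> thue_morse} \<longleftrightarrow>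
    (\<exists>s. i * 2 ^ e + r = k * 2 ^ z * s \<and> (d \<in> thue_morse \<longleftrightarrow> s \<in> thue_morse))"
proof -
  define c where "c = e - z"
  have e: "2 ^ e = 2 ^ z * (2 :: nat) ^ c"
    using assms(1) by (simp add: c_def flip: power_add)
  have split: "(k * d + i) * 2 ^ e + r = k * 2 ^ z * (d * 2 ^ c) + (i * 2 ^ e + r)"
    by (simp add: e algebra_simps)
  have "i * 2 ^ e + r < (i + 1) * 2 ^ e"
    using assms(3) by simp
  also have "\<dots> \<le> k * 2 ^ e"
    using assms(2) by (intro mult_right_mono) auto
  finally have less: "i * 2 ^ e + r < k * 2 ^ z * 2 ^ c"
    by (simp add: e mult.assoc)
  have small: "s < 2 ^ c" if "i * 2 ^ e + r = k * 2 ^ z * s" for s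
    using less that by simp
  show ?thesis
  proof
    assume "(k * d + i) * 2 ^ e + r \<in> {k * 2 ^ z * t | t. t \<in> thue_morse}"
    then obtain t where t: "t \<in> thue_morse"
      "k * 2 ^ z * t = k * 2 ^ z * (d * 2 ^ c) + (i * 2 ^ e + r)"
      unfolding split by auto
    define s where "s = t - d * 2 ^ c"
    have s: "i * 2 ^ e + r = k * 2 ^ z * s"
      using t(2) unfolding s_def by (simp only: diff_mult_distrib2)
    have "k * 2 ^ z * (d * 2 ^ c) \<le> k * 2 ^ z * t"
      using t(2) by linarith
    then have "d * 2 ^ c \<le> t"
      using assms(2) by simp
    then have "t = d * 2 ^ c + s"
      by (simp add: s_def)
    with t(1) s show "\<exists>s. i * 2 ^ e + r = k * 2 ^ z * s \<and> (d \<in> thue_morse \<longleftrightarrow> s \<in> thue_morse)"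
      using thue_morse_concat [OF small [OF s], of d] by blast
  next
    assume "\<exists>s. i * 2 ^ e + r = k * 2 ^ z * s \<and> (d \<in> thue_morse \<longleftrightarrow> s \<in> thue_morse)"
    then obtain s where s: "i * 2 ^ e + r = k * 2 ^ z * s" "d \<in> thue_morse \<longleftrightarrow> s \<in> thue_morse"
      by blast
    then have "d * 2 ^ c + s \<in> thue_morse"
      using thue_morse_concat [OF small [OF s(1)], of d] by blast
    moreover have "(k * d + i) * 2 ^ e + r = k * 2 ^ z * (d * 2 ^ c + s)"
      unfolding split s(1) by (simp add: distrib_left)
    ultimately show "(k * d + i) * 2 ^ e + r \<in> {k * 2 ^ z * t | t. t \<in> thue_morse}"
      by blast
  qed
qed

lemma concat_multiple_short:
  fixes n e r k z t :: nat
  assumes "e \<le> z" "r < 2 ^ e" "n * 2 ^ e + r = k * 2 ^ z * t"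
  shows "r = 0"
proof -
  have "(2 :: nat) ^ e dvd k * 2 ^ z * t"
    using assms(1) by (simp add: le_imp_power_dvd)
  then have "2 ^ e dvd r"
    by (simp add: assms(3) [symmetric] dvd_add_right_iff)
  then show ?thesis
    using assms(2) by (auto dest: dvd_imp_le)
qed

text \<open>The odd \<open>k\<close> is coprime to \<open>2 ^ e\<close>, so it must divide
  \<open>n\<close>. What remains is an equation between shifts of \<open>n div k\<close> and
  \<open>t\<close>, and shifts preserve membership in \<open>thue_morse\<close>.\<close>

lemma shifted_multiple_iff:
  assumes "odd k"
  shows "n * 2 ^ e \<in> {k * 2 ^ z * t | t. t \<in> thue_morse} \<longleftrightarrow>
    n mod k = 0 \<and> n div k \<in> thue_morse \<and> 2 ^ z dvd n div k * 2 ^ e"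
proof -
  have "k > 0"
    using assms by (rule odd_pos)
  show ?thesis
  proof
    assume "n * 2 ^ e \<in> {k * 2 ^ z * t | t. t \<in> thue_morse}"
    then obtain t where t: "t \<in> thue_morse" "n * 2 ^ e = k * (2 ^ z * t)"
      by auto
    then have "k dvd n * 2 ^ e"
      by simp
    then have "k dvd n"
      using assms by (simp add: coprime_dvd_mult_left_iff)
    then obtain d where d: "n = k * d"
      by blast
    have eq: "d * 2 ^ e = t * 2 ^ z"
      using t(2) \<open>k > 0\<close> by (simp add: d mult_ac)
    then have "d \<in> thue_morse"
      using t(1) thue_morse_mult_power by metis
    then show "n mod k = 0 \<and> n div k \<in> thue_morse \<and> 2 ^ z dvd n div k * 2 ^ e"
      using \<open>k > 0\<close> eq by (simp add: d)
  next
    assume *: "n mod k = 0 \<and> n div k \<in> thue_morse \<and> 2 ^ z dvd n div k * 2 ^ e"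
    then obtain t where t: "n div k * 2 ^ e = t * 2 ^ z"
      by (auto simp: mult.commute)
    then have "t \<in> thue_morse"
      using * thue_morse_mult_power by metis
    moreover have "n * 2 ^ e = k * (n div k * 2 ^ e)"
      using * by (auto simp flip: mult.assoc)
    ultimately show "n * 2 ^ e \<in> {k * 2 ^ z * t | t. t \<in> thue_morse}"
      unfolding t by (auto simp: mult_ac)
  qed
qed

section \<open>A complete invariant of the left quotients\<close>

text \<open>For \<open>p > 0\<close> and \<open>d > 0\<close> with 2-adic valuation
  \<open>v\<close>, this is the ceiling of \<open>(z - v) / p\<close>, cut off at 0; for
  \<open>d = 0\<close> it is 0.\<close>

definition threshold :: "nat \<Rightarrow> nat \<Rightarrow> nat \<Rightarrow> nat" where
  "threshold p z d = (LEAST l. 2 ^ z dvd d * 2 ^ (p * l))"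

lemma threshold_le_iff:
  assumes "p > 0"
  shows "threshold p z d \<le> l \<longleftrightarrow> 2 ^ z dvd d * 2 ^ (p * l)"
proof
  \<comment> \<open>The length \<open>z\<close> shows that the \<open>LEAST\<close> ranges over a
    nonempty set.\<close>
  have "z \<le> p * z"
    using assms by simp
  then have "2 ^ z dvd d * 2 ^ (p * z)"
    by (simp add: le_imp_power_dvd)
  then have "2 ^ z dvd d * 2 ^ (p * threshold p z d)"
    unfolding threshold_def by (rule LeastI)
  also assume "threshold p z d \<le> l"
  then have "d * 2 ^ (p * threshold p z d) dvd d * 2 ^ (p * l)"
    by (intro mult_dvd_mono le_imp_power_dvd mult_le_mono2) auto
  finally show "2 ^ z dvd d * 2 ^ (p * l)" .
next
  assume "2 ^ z dvd d * 2 ^ (p * l)"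
  then show "threshold p z d \<le> l"
    unfolding threshold_def by (rule Least_le)
qed

text \<open>Short continuations tell numbers apart only in the class of residue 0 with quotient in
  \<open>thue_morse\<close>; elsewhere the default 0 keeps the threshold from splitting a
  class.\<close>

definition state_invariant :: "nat \<Rightarrow> nat \<Rightarrow> nat \<Rightarrow> nat \<Rightarrow> nat \<times> bool \<times> nat" where
  "state_invariant p k z n =
    (n mod k, n div k \<in> thue_morse,
     if n mod k = 0 \<and> n div k \<in> thue_morse then threshold p z (n div k) else 0)"

lemma same_continuations_iff:
  fixes k z p n n' :: nat
  assumes "odd k" "p > 0"
  defines "X \<equiv> {k * 2 ^ z * t | t. t \<in> thue_morse}"
  shows "(\<forall>l. \<forall>r < (2 ^ p) ^ l. n * (2 ^ p) ^ l + r \<in> X \<longleftrightarrow> n' * (2 ^ p) ^ l + r \<in> X) \<longleftrightarrow>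
    state_invariant p k z n = state_invariant p k z n'"
proof -
  have "k > 0"
    using assms(1) by (rule odd_pos)
  have long: "n * 2 ^ e + r \<in> X \<longleftrightarrow>
      (\<exists>s. n mod k * 2 ^ e + r = k * 2 ^ z * s \<and> (n div k \<in> thue_morse \<longleftrightarrow> s \<in> thue_morse))"
    if "z \<le> e" "r < 2 ^ e" for n e r
    using concat_multiple_iff_long [OF that(1) _ that(2), of "n mod k" k "n div k"] \<open>k > 0\<close>
    by (simp add: X_def)
  have zero: "n * 2 ^ (p * l) \<in> X \<longleftrightarrow>
      n mod k = 0 \<and> n div k \<in> thue_morse \<and> threshold p z (n div k) \<le> l" for n l
    using shifted_multiple_iff [OF assms(1), of n "p * l" z]
    by (simp only: X_def threshold_le_iff [OF assms(2)])
  have short: "r = 0" if "n * 2 ^ e + r \<in> X" "e \<le> z" "r < 2 ^ e" for n e r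
    using that concat_multiple_short [of e z r n k] by (auto simp: X_def)
  have "(\<forall>l. \<forall>r < 2 ^ (p * l). n * 2 ^ (p * l) + r \<in> X \<longleftrightarrow> n' * 2 ^ (p * l) + r \<in> X) \<longleftrightarrow>
    state_invariant p k z n = state_invariant p k z n'" (is "?L \<longleftrightarrow> ?R")
  proof
    assume L: ?L
    define m where "m = k * 2 ^ z"
    \<comment> \<open>A multiple of \<open>p\<close> large enough for both
      \<open>4 * m \<le> 2 ^ e\<close> and \<open>z \<le> e\<close>.\<close>
    define e where "e = p * (4 * m)"
    have "m > 0"
      using \<open>k > 0\<close> by (simp add: m_def)
    have "4 * m \<le> e"
      using assms(2) by (simp add: e_def)
    moreover have "z < 2 ^ z" "e < 2 ^ e"
      by (rule less_exp)+
    moreover have "(2 :: nat) ^ z \<le> m"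
      using \<open>k > 0\<close> by (simp add: m_def)
    ultimately have "4 * m \<le> 2 ^ e" "z \<le> e"
      by linarith+
    then obtain r where r: "r < 2 ^ e" "n * 2 ^ e + r \<in> X"
      using ex_multiple_in_interval [of m e n] \<open>m > 0\<close> unfolding X_def m_def by blast
    then have "n' * 2 ^ e + r \<in> X"
      using L unfolding e_def by blast
    with r obtain s s' where
        s: "n mod k * 2 ^ e + r = k * (2 ^ z * s)" "n div k \<in> thue_morse \<longleftrightarrow> s \<in> thue_morse" and
        s': "n' mod k * 2 ^ e + r = k * (2 ^ z * s')" "n' div k \<in> thue_morse \<longleftrightarrow> s' \<in> thue_morse"
      using long [OF \<open>z \<le> e\<close> r(1)] by (metis mult.assoc)
    \<comment> \<open>Subtraction over the integers eliminates the common \<open>r\<close>; the odd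
      \<open>k\<close> then divides the difference of two residues below \<open>k\<close>.\<close>
    have "int k dvd (int (n mod k) * 2 ^ e + int r) - (int (n' mod k) * 2 ^ e + int r)"
    proof (rule dvd_diff)
      show "int k dvd int (n mod k) * 2 ^ e + int r"
        using arg_cong [OF s(1), of int] by simp
      show "int k dvd int (n' mod k) * 2 ^ e + int r"
        using arg_cong [OF s'(1), of int] by simp
    qed
    then have "int k dvd (int (n mod k) - int (n' mod k)) * 2 ^ e"
      by (simp add: algebra_simps)
    then have dvd: "int k dvd int (n mod k) - int (n' mod k)"
      using assms(1) by (simp add: coprime_dvd_mult_left_iff)
    have "n mod k < k" "n' mod k < k"
      using \<open>k > 0\<close> by simp_all
    then have "\<bar>int (n mod k) - int (n' mod k)\<bar> < int k"
      by linarith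
    with dvd have mod_eq: "n mod k = n' mod k"
      using dvd_imp_le_int [of "int (n mod k) - int (n' mod k)" "int k"] by fastforce
    then have "s = s'"
      using s(1) s'(1) \<open>k > 0\<close> by simp
    then have tm_eq: "n div k \<in> thue_morse \<longleftrightarrow> n' div k \<in> thue_morse"
      using s(2) s'(2) by simp
    have "threshold p z (n div k) = threshold p z (n' div k)"
      if "n mod k = 0" "n div k \<in> thue_morse"
    proof -
      \<comment> \<open>The continuations with \<open>r = 0\<close> reveal all upper bounds of the
        threshold.\<close>
      have "n * 2 ^ (p * l) \<in> X \<longleftrightarrow> n' * 2 ^ (p * l) \<in> X" for l
        using L [rule_format, of 0 l] by simp
      then have "threshold p z (n div k) \<le> l \<longleftrightarrow> threshold p z (n' div k) \<le> l" for l
        using that mod_eq tm_eq by (simp add: zero)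
      then show ?thesis
        using order_antisym by blast
    qed
    then show ?R
      using mod_eq tm_eq by (simp add: state_invariant_def)
  next
    assume ?R
    then have mod_eq: "n mod k = n' mod k"
      and tm_eq: "n div k \<in> thue_morse \<longleftrightarrow> n' div k \<in> thue_morse"
      and th_eq: "n mod k = 0 \<Longrightarrow> n div k \<in> thue_morse \<Longrightarrow>
        threshold p z (n div k) = threshold p z (n' div k)"
      by (auto simp: state_invariant_def split: if_splits)
    show ?L
    proof (intro allI impI)
      fix l r :: nat
      assume r: "r < 2 ^ (p * l)"
      show "n * 2 ^ (p * l) + r \<in> X \<longleftrightarrow> n' * 2 ^ (p * l) + r \<in> X"
      proof (cases "z \<le> p * l")
        case True
        then show ?thesis
          using r by (simp add: long mod_eq tm_eq)
      next
        case False
        show ?thesis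
        proof (cases "r = 0")
          case True
          then show ?thesis
            using mod_eq tm_eq th_eq by (auto simp: zero)
        next
          case r0: False
          \<comment> \<open>Both memberships fail, since a short continuation must have
            \<open>r = 0\<close>.\<close>
          then show ?thesis
            using short [OF _ _ r] False by auto
        qed
      qed
    qed
  qed
  then show ?thesis
    by (simp add: power_mult)
qed

section \<open>The values of the invariant and their number\<close>

lemma range_state_invariant:
  assumes "k > 0" "p > 0" and N: "\<And>l. N \<le> l \<longleftrightarrow> z \<le> p * l"
  shows "range (state_invariant p k z) = {..<k} \<times> UNIV \<times> {0} \<union> {0} \<times> {True} \<times> {1..N}"
    (is "_ = ?S")
proof
  have "threshold p z d \<le> N" for d
    using N [of N] by (simp add: threshold_le_iff [OF assms(2)] le_imp_power_dvd)
  then show "range (state_invariant p k z) \<subseteq> ?S"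
    using assms(1) by (auto simp: state_invariant_def Suc_le_eq split: if_splits)
next
  have th_0: "threshold p z 0 = 0"
    using threshold_le_iff [OF assms(2), of z 0 0] by simp
  \<comment> \<open>The odd factor 3 does not affect divisibility by \<open>2 ^ z\<close>, but
    unlike 1 it lies in \<open>thue_morse\<close>.\<close>
  have th_3: "threshold p z (3 * 2 ^ (z - p * j)) = j" if j: "1 \<le> j" "j \<le> N" for j
  proof -
    have "threshold p z (3 * 2 ^ (z - p * j)) \<le> l \<longleftrightarrow> j \<le> l" for l
    proof -
      have "coprime (2 ^ z) (3 :: nat)"
        by simp
      then have "(2 :: nat) ^ z dvd 3 * 2 ^ (z - p * j) * 2 ^ (p * l) \<longleftrightarrow>
          (2 :: nat) ^ z dvd 2 ^ (z - p * j + p * l)"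
        by (simp add: mult.assoc coprime_dvd_mult_right_iff power_add)
      also have "\<dots> \<longleftrightarrow> z \<le> z - p * j + p * l"
        by (simp add: dvd_power_iff_le)
      also have "\<dots> \<longleftrightarrow> j \<le> l"
      proof (cases "j \<le> l")
        case True
        then have "p * j \<le> p * l"
          by simp
        then show ?thesis
          using True by linarith
      next
        case False
        then have "p * l < p * j"
          using assms(2) by simp
        \<comment> \<open>This covers \<open>j = N\<close>, where \<open>p * j\<close> may exceed
          \<open>z\<close> and \<open>z - p * j\<close> is truncated to 0.\<close>
        moreover have "p * l < z"
          using N [of l] False j by linarith
        ultimately show ?thesis
          using False by linarith
      qed
      finally show ?thesis
        by (simp add: threshold_le_iff [OF assms(2)])
    qed
    then show ?thesis
      using order_antisym by blast
  qed
  show "?S \<subseteq> range (state_invariant p k z)"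
  proof
    fix x assume "x \<in> ?S"
    then consider i where "i < k" "x = (i, True, 0)" | i where "i < k" "x = (i, False, 0)"
      | j where "1 \<le> j" "j \<le> N" "x = (0, True, j)"
      by auto
    then show "x \<in> range (state_invariant p k z)"
    proof cases
      case 1
      then have "x = state_invariant p k z i"
        by (simp add: state_invariant_def zero_in_thue_morse th_0)
      then show ?thesis
        by blast
    next
      case 2
      \<comment> \<open>The quotient is 1, which is not in \<open>thue_morse\<close>.\<close>
      then have "x = state_invariant p k z (k + i)"
        using one_notin_thue_morse by (simp add: state_invariant_def)
      then show ?thesis
        by blast
    next
      case 3
      then have "x = state_invariant p k z (k * (3 * 2 ^ (z - p * j)))"
        using assms(1) th_3
        by (simp add: state_invariant_def thue_morse_mult_power three_in_thue_morse)
      then show ?thesis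
        by blast
    qed
  qed
qed

theorem theorem3:
  fixes m p k z :: nat
  assumes "m > 0" and "p > 0"
    and "m = k * 2 ^ z" and "odd k"
  shows "int (state_complexity_base (2 ^ p) {m * t | t. t \<in> thue_morse})
           = 2 * int k + \<lceil>real z / real p\<rceil>"
proof -
  define N where "N = nat \<lceil>real z / real p\<rceil>"
  have "0 \<le> real z / real p"
    by simp
  then have int_N: "int N = \<lceil>real z / real p\<rceil>"
    unfolding N_def by linarith
  have N: "N \<le> l \<longleftrightarrow> z \<le> p * l" for l
  proof -
    have "N \<le> l \<longleftrightarrow> real z / real p \<le> real l"
      by (simp add: N_def nat_le_iff ceiling_le_iff)
    also have "\<dots> \<longleftrightarrow> real z \<le> real (p * l)"
      using assms(2) by (simp add: field_simps)
    finally show ?thesis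
      by (simp only: of_nat_le_iff)
  qed
  have "(2 :: nat) ^ 1 \<le> 2 ^ p"
    using assms(2) by (intro power_increasing) auto
  then have "(2 :: nat) \<le> 2 ^ p"
    by simp
  then have "state_complexity_base (2 ^ p) {m * t | t. t \<in> thue_morse} =
      card (range (state_invariant p k z))"
    unfolding assms(3)
    by (rule state_complexity_base_eq_card_range) (rule same_continuations_iff [OF assms(4,2)])
  also have "\<dots> = card ({..<k} \<times> (UNIV :: bool set) \<times> {0 :: nat} \<union> {0} \<times> {True} \<times> {1..N})"
    by (simp only: range_state_invariant [OF odd_pos [OF assms(4)] assms(2) N])
  \<comment> \<open>The two sets are disjoint because the last component is 0 in one and at least 1
    in the other.\<close>
  also have "\<dots> = 2 * k + N"
    by (subst card_Un_disjoint) (auto simp: card_cartesian_product)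
  finally show ?thesis
    by (simp add: int_N)
qed

end
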